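(* Let $d\ge1$ be an integer, $\tau>0$, $s\in\mathbb{R}$. If $C\in L^{\infty}([s,s+\tau]\times[-\tau,0],\mathbb{R}^{d\times d})$ and $\phi\in X=L^2([-\tau,0],\mathbb{R}^d)$, then the initial value problem defined by $$x(t)=\int_{-\tau}^0C(t,\theta)\,x_t(\theta)\,d\theta,\quad t>s,\qquad x_s=\phi,$$ has a unique solution $x\in L^2([s,s+\tau],\mathbb{R}^d)$ on $[s,s+\tau]$.
   Context: For a function $x$ defined on $[s-\tau,s+\tau]$, $x_t(\theta)=x(t+\theta)$ for $t\in[s,s+\tau]$, $\theta\in[-\tau,0]$. A solution on $[s,s+\tau]$ is a function $x$ whose extension to $[s-\tau,s]$ by $x(s+\theta)=\phi(\theta)$ satisfies the equation for almost every $t\in[s,s+\tau]$; functions are identified when equal almost everywhere. *)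

theory Defs
  imports "HOL-Analysis.Analysis"
begin

text \<open>
  The Lebesgue spaces are represented by their functions rather than by equivalence classes;
  the identification of functions that agree almost everywhere is made explicit where it matters.
  Functions are total in HOL, but only their values on \<open>S\<close> are relevant.
\<close>

definition L2_on :: "'a::euclidean_space set \<Rightarrow> ('a \<Rightarrow> 'b::real_normed_vector) set" where
  "L2_on S = {f \<in> borel_measurable (lebesgue_on S).
                integrable (lebesgue_on S) (\<lambda>x. (norm (f x))\<^sup>2)}"

text \<open>For matrix values the norm below is the Frobenius norm; any other norm on the
  finite-dimensional space of matrices gives the same set of functions.\<close>

definition Linf_on :: "'a::euclidean_space set \<Rightarrow> ('a \<Rightarrow> 'b::real_normed_vector) set" where
  "Linf_on S = {f \<in> borel_measurable (lebesgue_on S).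
                  \<exists>B. AE x in lebesgue_on S. norm (f x) \<le> B}"

definition history :: "(real \<Rightarrow> 'b) \<Rightarrow> real \<Rightarrow> real \<Rightarrow> 'b" where
  "history x t = (\<lambda>\<theta>. x (t + \<theta>))"

definition extend_by :: "real \<Rightarrow> (real \<Rightarrow> 'b) \<Rightarrow> (real \<Rightarrow> 'b) \<Rightarrow> real \<Rightarrow> 'b" where
  "extend_by s \<phi> x = (\<lambda>t. if t \<le> s then \<phi> (t - s) else x t)"

text \<open>The Bochner integral of a non-integrable function is 0 by convention, so integrability
  of the integrand is part of what it means to satisfy the equation at \<open>t\<close>.\<close>

definition satisfies_eq_at ::
    "real \<Rightarrow> (real \<times> real \<Rightarrow> real ^ 'd ^ 'd) \<Rightarrow> (real \<Rightarrow> real ^ 'd) \<Rightarrow> real \<Rightarrow> bool" where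
  "satisfies_eq_at \<tau> C x t \<longleftrightarrow>
     integrable (lebesgue_on {-\<tau>..0}) (\<lambda>\<theta>. C (t, \<theta>) *v history x t \<theta>) \<and>
     x t = integral\<^sup>L (lebesgue_on {-\<tau>..0}) (\<lambda>\<theta>. C (t, \<theta>) *v history x t \<theta>)"

definition is_solution ::
    "real \<Rightarrow> real \<Rightarrow> (real \<times> real \<Rightarrow> real ^ 'd ^ 'd) \<Rightarrow> (real \<Rightarrow> real ^ 'd) \<Rightarrow> (real \<Rightarrow> real ^ 'd) \<Rightarrow> bool"
  where
  "is_solution s \<tau> C \<phi> x \<longleftrightarrow>
     (AE t in lebesgue_on {s..s + \<tau>}. satisfies_eq_at \<tau> C (extend_by s \<phi> x) t)"

end

theory Submission
  imports Defs
begin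

text \<open>
  Replace \<open>C\<close> by a bounded Borel kernel \<open>K\<close> that vanishes off the rectangle and agrees with \<open>C\<close>
  almost everywhere there, and let \<open>V u t = \<integral> K(t, \<theta>) u(t + \<theta>) d\<theta>\<close>. With \<open>u\<close> the initial datum
  extended by zero, the extended solution is a fixed point of \<open>x \<mapsto> u + V x\<close> on the whole line,
  up to null sets. The operator \<open>V\<close> maps integrable functions to bounded ones, and since \<open>\<theta> \<le> 0\<close>
  it halves every bound of the form \<open>M exp (2 B t)\<close>, where \<open>B\<close> bounds \<open>K\<close>. So the
  Neumann series \<open>u + V u + V (V u) + \<dots>\<close> converges to a fixed point, and an integrable solution
  of \<open>z = V z\<close> vanishes almost everywhere.
\<close>

section \<open>Matrix-vector products, Borel representatives and translations\<close>

lemma bounded_bilinear_matrix_vector_mult: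
  "bounded_bilinear ((*v) :: real^'n^'m \<Rightarrow> real^'n \<Rightarrow> real^'m)"
proof -
  have "bilinear ((*v) :: real^'n^'m \<Rightarrow> real^'n \<Rightarrow> real^'m)"
    unfolding bilinear_def
    by (auto intro!: linearI simp: matrix_vector_mult_add_rdistrib matrix_vector_right_distrib
        matrix_vector_mult_scaleR scaleR_matrix_vector_assoc)
  then show ?thesis
    by (simp add: bilinear_conv_bounded_bilinear)
qed

lemma borel_measurable_matrix_vector_mult [measurable]:
  fixes f :: "'a \<Rightarrow> real^'n^'m"
  assumes "f \<in> borel_measurable M" "g \<in> borel_measurable M"
  shows "(\<lambda>x. f x *v g x) \<in> borel_measurable M"
  by (rule borel_measurable_continuous_Pair[OF assms])
    (auto intro!: bounded_bilinear.continuous_on[OF bounded_bilinear_matrix_vector_mult] continuous_intros)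

text \<open>Borel measurability is preserved under compositions such as
  \<open>u (t + \<theta>)\<close> and yields joint measurability of the integrands. The extension by
  zero is treated coordinate by coordinate; the finitely many exceptional null sets combine.\<close>

lemma lebesgue_measurable_ex_borel:
  fixes f :: "'a::euclidean_space \<Rightarrow> 'b::euclidean_space"
  assumes "f \<in> borel_measurable (lebesgue_on S)" "S \<in> sets lebesgue"
  obtains g where "g \<in> borel_measurable borel" "AE x in lborel. x \<in> S \<longrightarrow> f x = g x"
proof -
  define h where "h x = (if x \<in> S then f x else 0)" for x
  have h: "h \<in> borel_measurable lebesgue"
    unfolding h_def using assms by (rule borel_measurable_if_I)
  have "\<exists>g\<in>borel_measurable lborel. AE x in lborel. h x \<bullet> b = g x" for b
    using h by (intro completion_ex_borel_measurable_real borel_measurable_inner borel_measurable_const)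
  then obtain g where g: "\<And>b. g b \<in> borel_measurable lborel"
      "\<And>b. AE x in lborel. h x \<bullet> b = g b x"
    by metis
  have "AE x in lborel. \<forall>b\<in>Basis. h x \<bullet> b = g b x"
    using g(2) by (intro AE_finite_allI) auto
  then have "AE x in lborel. h x = (\<Sum>b\<in>Basis. g b x *\<^sub>R b)"
    by eventually_elim (metis (no_types, lifting) euclidean_representation sum.cong)
  then have "AE x in lborel. x \<in> S \<longrightarrow> f x = (\<Sum>b\<in>Basis. g b x *\<^sub>R b)"
    by eventually_elim (auto simp: h_def)
  moreover have "(\<lambda>x. \<Sum>b\<in>Basis. g b x *\<^sub>R b) \<in> borel_measurable borel"
    using g(1) by simp
  ultimately show ?thesis
    using that by blast
qed

lemma AE_lebesgue_on_iff:
  "S \<in> sets lebesgue \<Longrightarrow> (AE x in lebesgue_on S. P x) \<longleftrightarrow> (AE x in lborel. x \<in> S \<longrightarrow> P x)"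
  by (simp add: AE_restrict_space_iff AE_completion_iff)

text \<open>Returns from Borel representatives under \<open>lborel\<close> to integrals under
  \<open>lebesgue_on S\<close>. Measurability of \<open>f\<close> comes from completeness of
  Lebesgue measure.\<close>

lemma lebesgue_on_integral_eq_lborel:
  fixes f g :: "'a::euclidean_space \<Rightarrow> 'b::euclidean_space"
  assumes "S \<in> sets lebesgue" "integrable lborel g"
    and "AE x in lborel. g x = indicator S x *\<^sub>R f x"
  shows "integrable (lebesgue_on S) f" "integral\<^sup>L (lebesgue_on S) f = integral\<^sup>L lborel g"
proof -
  have [measurable]: "g \<in> borel_measurable borel"
    using borel_measurable_integrable[OF assms(2)] by simp
  have g: "g \<in> borel_measurable lebesgue"
    by (simp add: measurable_completion)
  have ae: "AE x in lebesgue. g x = indicator S x *\<^sub>R f x"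
    using assms(3) by (simp add: AE_completion_iff)
  have f: "(\<lambda>x. indicator S x *\<^sub>R f x) \<in> borel_measurable lebesgue"
    by (rule borel_measurable_AE[OF g ae])
  have int: "integrable lebesgue g"
    using assms(2) by (simp add: integrable_completion)
  show "integrable (lebesgue_on S) f"
    using integrable_cong_AE_imp[OF int f ae] assms(1) by (simp add: integrable_restrict_space)
  show "integral\<^sup>L (lebesgue_on S) f = integral\<^sup>L lborel g"
    using integral_cong_AE[OF g f ae] assms(1)
    by (simp add: integral_restrict_space integral_completion)
qed

text \<open>On a bounded interval square integrability implies integrability, by
  \<open>r \<le> 1 + r\<^sup>2\<close>. Cut off outside the interval, the Borel representative is
  integrable on the line, the setting in which the integral operator acts.\<close>

lemma L2_on_ex_borel:
  fixes f :: "real \<Rightarrow> 'b::euclidean_space"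
  assumes "f \<in> L2_on {a..b}"
  obtains g where "integrable lborel g" "\<And>x. x \<notin> {a..b} \<Longrightarrow> g x = 0"
    "AE x in lborel. x \<in> {a..b} \<longrightarrow> g x = f x"
proof -
  have f: "f \<in> borel_measurable (lebesgue_on {a..b})"
      "integrable (lebesgue_on {a..b}) (\<lambda>x. (norm (f x))\<^sup>2)"
    using assms by (auto simp: L2_on_def)
  obtain h where [measurable]: "h \<in> borel_measurable borel"
    and h: "AE x in lborel. x \<in> {a..b} \<longrightarrow> f x = h x"
    using lebesgue_measurable_ex_borel[OF f(1)] by auto
  define g where "g x = indicator {a..b} x *\<^sub>R h x" for x
  have [measurable]: "g \<in> borel_measurable borel"
    unfolding g_def by measurable
  have "integrable (lebesgue_on {a..b}) f"
  proof (rule Bochner_Integration.integrable_bound)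
    show "integrable (lebesgue_on {a..b}) (\<lambda>x. 1 + (norm (f x))\<^sup>2)"
      using f(2) by (intro Bochner_Integration.integrable_add) auto
    have "r \<le> 1 + r\<^sup>2" for r :: real
      using zero_le_power2[of r] self_le_power[of r 2] by (cases "r \<le> 1") linarith+
    then show "AE x in lebesgue_on {a..b}. norm (f x) \<le> norm (1 + (norm (f x))\<^sup>2)"
      by (simp add: abs_of_nonneg)
  qed (rule f)
  then have int: "integrable lebesgue (\<lambda>x. indicator {a..b} x *\<^sub>R f x)"
    by (simp add: integrable_restrict_space)
  have ae: "AE x in lborel. indicator {a..b} x *\<^sub>R f x = g x"
    using h by eventually_elim (auto simp: g_def indicator_def)
  have "integrable lebesgue g"
    by (rule integrable_cong_AE_imp[OF int])
      (use ae in \<open>auto simp: AE_completion_iff measurable_completion\<close>)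
  then have "integrable lborel g"
    by (simp add: integrable_completion)
  moreover have "AE x in lborel. x \<in> {a..b} \<longrightarrow> g x = f x"
    using h by eventually_elim (auto simp: g_def)
  ultimately show ?thesis
    using that by (simp add: g_def)
qed

lemma lborel_integrable_shift:
  fixes u :: "real \<Rightarrow> 'b::euclidean_space"
  shows "integrable lborel u \<Longrightarrow> integrable lborel (\<lambda>\<theta>. u (t + \<theta>))"
  using lborel_integrable_real_affine[of u 1 t] by simp

text \<open>The set described by \<open>P\<close> may be non-measurable, so the exceptional set is
  enlarged to a Borel null set, whose translates are null.\<close>

lemma AE_lborel_shift:
  fixes P :: "real \<Rightarrow> bool"
  assumes "AE x in lborel. P x"
  shows "AE x in lborel. P (t + x)"
proof -
  obtain N where N: "{x. \<not> P x} \<subseteq> N" "N \<in> null_sets lborel"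
    using assms by (auto simp: eventually_ae_filter)
  have "Measurable.pred borel (\<lambda>x. x \<notin> N)"
  proof -
    have [measurable]: "N \<in> sets borel"
      using N(2) by auto
    show ?thesis by measurable
  qed
  then have "AE x in lborel. t + 1 * x \<notin> N"
    using AE_not_in[OF N(2)] by (intro AE_borel_affine) auto
  then show ?thesis
    by eventually_elim (use N(1) in auto)
qed

section \<open>The Volterra operator of a bounded Borel kernel\<close>

text \<open>The support is half-open at \<open>s\<close>, so that the fixed-point equation returns
  the initial datum at \<open>t = s\<close>. The bound holds at every point, which makes the
  estimates on the operator valid at every \<open>t\<close>.\<close>

locale delay_kernel =
  fixes K :: "real \<times> real \<Rightarrow> real ^ 'd ^ 'd" and s \<tau> B :: real
  assumes K_measurable [measurable]: "K \<in> borel_measurable borel"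
    and K_bound: "\<And>p v. norm (K p *v v) \<le> B * norm v"
    and K_support: "\<And>p. p \<notin> {s<..s + \<tau>} \<times> {-\<tau>..0} \<Longrightarrow> K p = 0"
    and B_pos: "B > 0" and \<tau>_pos: "\<tau> > 0"
begin

text \<open>With \<open>\<sigma> = t + \<theta>\<close> this is a Volterra operator with kernel
  \<open>K (t, \<sigma> - t)\<close>, supported in \<open>\<sigma> \<le> t\<close>; the support of
  \<open>K\<close> lets the integral run over the whole line.\<close>

definition V :: "(real \<Rightarrow> real ^ 'd) \<Rightarrow> real \<Rightarrow> real ^ 'd" where
  "V u t = (\<integral>\<theta>. K (t, \<theta>) *v u (t + \<theta>) \<partial>lborel)"

lemma V_measurable [measurable]:
  assumes [measurable]: "u \<in> borel_measurable borel"
  shows "V u \<in> borel_measurable borel"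
proof -
  have "(\<lambda>t. \<integral>\<theta>. K (t, \<theta>) *v u (t + \<theta>) \<partial>lborel) \<in> borel_measurable borel"
    by (rule lborel.borel_measurable_lebesgue_integral)
      (simp add: case_prod_beta, measurable)
  then show ?thesis
    by (simp add: V_def[abs_def])
qed

lemma V_support: "t \<notin> {s<..s + \<tau>} \<Longrightarrow> V u t = 0"
  unfolding V_def by (subst K_support) auto

lemma V_integrand_integrable:
  assumes "integrable lborel u"
  shows "integrable lborel (\<lambda>\<theta>. K (t, \<theta>) *v u (t + \<theta>))"
proof (rule Bochner_Integration.integrable_bound)
  have [measurable]: "u \<in> borel_measurable borel"
    using borel_measurable_integrable[OF assms] by simp
  show "integrable lborel (\<lambda>\<theta>. B *\<^sub>R u (t + \<theta>))"
    using lborel_integrable_shift[OF assms] by simp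
  show "(\<lambda>\<theta>. K (t, \<theta>) *v u (t + \<theta>)) \<in> borel_measurable lborel"
    by measurable
qed (use K_bound B_pos in simp)

lemma V_add:
  assumes "integrable lborel u" "integrable lborel v"
  shows "V (\<lambda>t. u t + v t) t = V u t + V v t"
  by (simp add: V_def matrix_vector_right_distrib V_integrand_integrable assms)

lemma V_diff:
  assumes "integrable lborel u" "integrable lborel v"
  shows "V (\<lambda>t. u t - v t) t = V u t - V v t"
  by (simp add: V_def matrix_vector_mult_diff_distrib V_integrand_integrable assms)

lemma V_sum:
  fixes u :: "nat \<Rightarrow> real \<Rightarrow> real ^ 'd"
  assumes "\<And>n. integrable lborel (u n)"
  shows "V (\<lambda>t. \<Sum>i<n. u i t) t = (\<Sum>i<n. V (u i) t)"
proof (induction n)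
  case 0
  show ?case by (simp add: V_def)
next
  case (Suc n)
  then show ?case by (simp add: V_add assms)
qed

text \<open>Translation invariance of Lebesgue measure makes the bound uniform in \<open>t\<close>:
  one application of \<open>V\<close> turns an integrable function into a bounded one.\<close>

lemma norm_V_le:
  assumes "integrable lborel u"
  shows "norm (V u t) \<le> B * (\<integral>\<sigma>. norm (u \<sigma>) \<partial>lborel)"
proof -
  have "norm (V u t) \<le> (\<integral>\<theta>. norm (K (t, \<theta>) *v u (t + \<theta>)) \<partial>lborel)"
    unfolding V_def by (rule integral_norm_bound)
  also have "\<dots> \<le> (\<integral>\<theta>. B * norm (u (t + \<theta>)) \<partial>lborel)"
    using V_integrand_integrable[OF assms] lborel_integrable_shift[OF assms] K_bound
    by (intro integral_mono) auto
  also have "\<dots> = B * (\<integral>\<sigma>. norm (u \<sigma>) \<partial>lborel)"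
    using lborel_integral_real_affine[of 1 "\<lambda>\<sigma>. norm (u \<sigma>)" t] by simp
  finally show ?thesis .
qed

lemma bounded_support_integrable:
  fixes f :: "real \<Rightarrow> 'b::euclidean_space"
  assumes "f \<in> borel_measurable borel" "\<And>t. t \<notin> {s<..s + \<tau>} \<Longrightarrow> f t = 0" "\<And>t. norm (f t) \<le> D"
  shows "integrable lborel f"
proof (rule Bochner_Integration.integrable_bound)
  show "integrable lborel (\<lambda>t. D * indicator {s..s + \<tau>} t :: real)"
    using \<tau>_pos by (intro integrable_mult_right integrable_real_indicator) auto
  show "AE t in lborel. norm (f t) \<le> norm (D * indicator {s..s + \<tau>} t :: real)"
    using assms(2,3) by (intro AE_I2) (fastforce simp: indicator_def intro: order_trans)
qed (use assms in simp)

lemma V_integrable: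
  assumes "integrable lborel u"
  shows "integrable lborel (V u)"
proof (rule bounded_support_integrable[OF _ V_support norm_V_le[OF assms]])
  show "V u \<in> borel_measurable borel"
    using borel_measurable_integrable[OF assms] by simp
qed auto

text \<open>Contraction in an exponentially weighted norm: integrating
  \<open>B * M * exp (2 * B * (t + \<theta>))\<close> over \<open>\<theta> \<le> 0\<close> divides
  by the rate \<open>2 * B\<close>, which leaves the factor 1/2. An almost everywhere bound becomes
  one at every \<open>t\<close>, since \<open>V\<close> sees \<open>u\<close> only up to null
  sets.\<close>

lemma V_contraction:
  assumes [measurable]: "u \<in> borel_measurable borel"
    and bound: "AE t in lborel. norm (u t) \<le> M * exp (2 * B * t)" and "M \<ge> 0"
  shows "norm (V u t) \<le> M / 2 * exp (2 * B * t)"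
proof -
  have "AE \<theta> in lborel. norm (u (t + \<theta>)) \<le> M * exp (2 * B * (t + \<theta>))"
    using AE_borel_affine[of 1 "\<lambda>t. norm (u t) \<le> M * exp (2 * B * t)" t] bound by simp
  then have le: "AE \<theta> in lborel. norm (K (t, \<theta>) *v u (t + \<theta>))
      \<le> (B * M * exp (2 * B * (t + \<theta>))) * indicator {-\<tau>..0} \<theta>"
  proof eventually_elim
    case (elim \<theta>)
    show ?case
    proof (cases "\<theta> \<in> {-\<tau>..0}")
      case True
      have "norm (K (t, \<theta>) *v u (t + \<theta>)) \<le> B * norm (u (t + \<theta>))"
        by (rule K_bound)
      also have "\<dots> \<le> B * (M * exp (2 * B * (t + \<theta>)))"
        using elim B_pos by simp
      finally show ?thesis
        using True by simp
    qed (simp add: K_support)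
  qed
  \<comment> \<open>The antiderivative is \<open>M / 2 * exp (2 * B * (t + \<theta>))\<close>; its
    value at \<open>-\<tau>\<close> is subtracted and finally discarded.\<close>
  have FTC: "has_bochner_integral lborel
      (\<lambda>\<theta>. (B * M * exp (2 * B * (t + \<theta>))) * indicator {-\<tau>..0} \<theta>)
      (M / 2 * exp (2 * B * (t + 0)) - M / 2 * exp (2 * B * (t + - \<tau>)))"
    using \<tau>_pos by (intro has_bochner_integral_FTC_Icc_real)
      (auto intro!: derivative_eq_intros continuous_intros)
  \<comment> \<open>Integrability comes from domination, as \<open>u\<close> is only measurable
    here.\<close>
  have int: "integrable lborel (\<lambda>\<theta>. K (t, \<theta>) *v u (t + \<theta>))"
    by (rule Bochner_Integration.integrable_bound[OF integrable.intros[OF FTC]])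
      (use le in auto)
  have "norm (V u t) \<le> (\<integral>\<theta>. norm (K (t, \<theta>) *v u (t + \<theta>)) \<partial>lborel)"
    unfolding V_def by (rule integral_norm_bound)
  also have "\<dots> \<le> (\<integral>\<theta>. (B * M * exp (2 * B * (t + \<theta>))) * indicator {-\<tau>..0} \<theta> \<partial>lborel)"
    using int FTC le by (intro integral_mono_AE) (auto simp: has_bochner_integral_iff)
  also have "\<dots> = M / 2 * exp (2 * B * (t + 0)) - M / 2 * exp (2 * B * (t + - \<tau>))"
    using FTC by (simp add: has_bochner_integral_iff)
  also have "\<dots> \<le> M / 2 * exp (2 * B * t)"
    using \<open>M \<ge> 0\<close> by simp
  finally show ?thesis .
qed

section \<open>Uniqueness and existence of fixed points by iterated contraction\<close>

lemma V_fixpoint_unique: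
  assumes z: "integrable lborel z" and fix_z: "AE t in lborel. z t = V z t"
  shows "AE t in lborel. z t = 0"
proof -
  have [measurable]: "z \<in> borel_measurable borel"
    using borel_measurable_integrable[OF z] by simp
  \<comment> \<open>\<open>D\<close> bounds \<open>V z\<close> everywhere, and \<open>M\<close> is
    scaled so that \<open>M * exp (2 * B * t) \<ge> D\<close> for \<open>t \<ge> s\<close>; for
    \<open>t \<le> s\<close> the function \<open>V z\<close> vanishes. This starts the induction,
    and each use of \<open>z = V z\<close> halves the bound.\<close>
  define D where "D = B * (\<integral>\<sigma>. norm (z \<sigma>) \<partial>lborel)"
  define M where "M = D * exp (- (2 * B * s))"
  have "D \<ge> 0"
    using B_pos by (simp add: D_def)
  then have "M \<ge> 0"
    by (simp add: M_def)
  have bound: "AE t in lborel. norm (z t) \<le> M / 2 ^ n * exp (2 * B * t)" for n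
  proof (induction n)
    case 0
    show ?case
      using fix_z
    proof eventually_elim
      case (elim t)
      show ?case
      proof (cases "t > s")
        case True
        have "norm (z t) \<le> D"
          using norm_V_le[OF z, of t] elim by (simp add: D_def)
        also have "\<dots> \<le> D * exp (2 * B * (t - s))"
          using True B_pos \<open>D \<ge> 0\<close> by (simp add: mult_le_cancel_left1)
        finally show ?thesis
          by (simp add: M_def mult.assoc flip: exp_add) (simp add: algebra_simps)
      next
        case False
        then show ?thesis
          using elim V_support[of t z] \<open>M \<ge> 0\<close> by simp
      qed
    qed
  next
    case (Suc n)
    show ?case
      using fix_z
    proof eventually_elim
      case (elim t)
      show ?case
        using V_contraction[OF _ Suc, of t] elim \<open>M \<ge> 0\<close> by (simp add: mult.commute)
    qed
  qed
  \<comment> \<open>A countable union of null sets is null, so one exceptional set serves all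
    \<open>n\<close>.\<close>
  have "AE t in lborel. \<forall>n. norm (z t) \<le> M / 2 ^ n * exp (2 * B * t)"
    using bound by (simp add: AE_all_countable)
  then show ?thesis
  proof eventually_elim
    case (elim t)
    have "(\<lambda>n. M / 2 ^ n * exp (2 * B * t)) \<longlonglongrightarrow> 0"
      by (intro tendsto_mult_left_zero tendsto_divide_zero LIMSEQ_divide_realpow_zero) auto
    then have "norm (z t) \<le> 0"
      by (rule LIMSEQ_le_const) (use elim in auto)
    then show ?case by simp
  qed
qed

lemma V_fixpoint_exists:
  assumes u: "integrable lborel u"
  obtains x where "integrable lborel x" "\<And>t. x t = u t + V x t"
proof -
  \<comment> \<open>The series starts at \<open>V u\<close>, not at \<open>u\<close>: the datum
    \<open>u\<close> is only integrable, while every \<open>w n\<close> is bounded and supported in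
    \<open>{s<..s + \<tau>}\<close>. The fixed point will be \<open>u + y\<close> with
    \<open>y\<close> the sum of the \<open>w n\<close>.\<close>
  define w where "w n = (V ^^ Suc n) u" for n
  have w0: "w 0 = V u" and w_Suc: "w (Suc n) = V (w n)" for n
    by (simp_all add: w_def)
  have w_int: "integrable lborel (w n)" for n
    by (induction n) (simp_all add: w0 w_Suc V_integrable u)
  have [measurable]: "w n \<in> borel_measurable borel" for n
    using borel_measurable_integrable[OF w_int] by simp
  define D where "D = B * (\<integral>\<sigma>. norm (u \<sigma>) \<partial>lborel)"
  define M where "M = D * exp (- (2 * B * s))"
  have "D \<ge> 0"
    using B_pos by (simp add: D_def)
  then have "M \<ge> 0"
    by (simp add: M_def)
  have w_supp: "w n t = 0" if "t \<notin> {s<..s + \<tau>}" for n t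
    using that by (cases n) (simp_all add: w0 w_Suc V_support)
  have w_bound: "norm (w n t) \<le> M / 2 ^ n * exp (2 * B * t)" for n t
  proof (induction n arbitrary: t)
    case 0
    show ?case
    proof (cases "t > s")
      case True
      have "norm (w 0 t) \<le> D"
        using norm_V_le[OF u, of t] by (simp add: D_def w0)
      also have "\<dots> \<le> D * exp (2 * B * (t - s))"
        using True B_pos \<open>D \<ge> 0\<close> by (simp add: mult_le_cancel_left1)
      finally show ?thesis
        by (simp add: M_def mult.assoc flip: exp_add) (simp add: algebra_simps)
    next
      case False
      then show ?thesis
        using w_supp[of t 0] \<open>M \<ge> 0\<close> by simp
    qed
  next
    case (Suc n)
    show ?case
      using V_contraction[of "w n" "M / 2 ^ n" t] Suc \<open>M \<ge> 0\<close> by (simp add: w_Suc mult.commute)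
  qed
  define y where "y t = (\<Sum>n. w n t)" for t
  have geo: "(\<lambda>i. M / 2 ^ (i + n) * exp (2 * B * t)) sums (2 * M / 2 ^ n * exp (2 * B * t))" for t n
    using sums_mult[OF geometric_sums[of "1/2 :: real"], of "M / 2 ^ n * exp (2 * B * t)"]
    by (simp add: power_add field_simps)
  have w_summable: "summable (\<lambda>n. w n t)" for t
    by (rule summable_comparison_test'[OF sums_summable[OF geo[of 0]]]) (use w_bound in simp)
  \<comment> \<open>The factor 2 is the sum of the geometric series of ratio 1/2. At
    \<open>n = 0\<close> the estimate bounds \<open>y\<close> itself.\<close>
  have tail: "norm (y t - (\<Sum>i<n. w i t)) \<le> 2 * M / 2 ^ n * exp (2 * B * t)" for t n
  proof -
    have "y t - (\<Sum>i<n. w i t) = (\<Sum>i. w (i + n) t)"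
      unfolding y_def using suminf_minus_initial_segment[OF w_summable] by simp
    also have "norm \<dots> \<le> (\<Sum>i. M / 2 ^ (i + n) * exp (2 * B * t))"
      by (rule norm_suminf_le[OF w_bound sums_summable[OF geo]])
    also have "\<dots> = 2 * M / 2 ^ n * exp (2 * B * t)"
      using sums_unique[OF geo] by simp
    finally show ?thesis .
  qed
  have y_meas [measurable]: "y \<in> borel_measurable borel"
    unfolding y_def[abs_def] by measurable
  have y_int: "integrable lborel y"
  proof (rule bounded_support_integrable[OF y_meas])
    show "y t = 0" if "t \<notin> {s<..s + \<tau>}" for t
      by (simp add: y_def w_supp[OF that])
    show "norm (y t) \<le> 2 * M * exp (2 * B * (s + \<tau>))" for t
    proof (cases "t \<in> {s<..s + \<tau>}")
      case True
      have "norm (y t) \<le> 2 * M * exp (2 * B * t)"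
        using tail[of t 0] by simp
      also have "\<dots> \<le> 2 * M * exp (2 * B * (s + \<tau>))"
        using True B_pos \<open>M \<ge> 0\<close> by (intro mult_left_mono) auto
      finally show ?thesis .
    next
      case False
      then show ?thesis
        using \<open>M \<ge> 0\<close> by (simp add: y_def w_supp)
    qed
  qed
  \<comment> \<open>\<open>V\<close> is exchanged with the infinite sum by applying
    \<open>V_contraction\<close> to the tails \<open>y - P n\<close>.\<close>
  have "V y t = y t - w 0 t" for t
  proof -
    define P where "P n t = (\<Sum>i<n. w i t)" for n t
    have P_int: "integrable lborel (P n)" for n
      unfolding P_def[abs_def] by (simp add: w_int)
    \<comment> \<open>\<open>V\<close> shifts the index by one, so \<open>V (P n)\<close> is the sum
      of \<open>w 1\<close> to \<open>w n\<close>.\<close>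
    have VP: "V (P n) t = P (Suc n) t - w 0 t" for n
      using V_sum[of w n t] w_int unfolding P_def[abs_def]
      by (simp add: sum.lessThan_Suc_shift w_Suc del: sum.lessThan_Suc)
    have "norm (V y t - V (P n) t) \<le> (2 * M / 2 ^ n) / 2 * exp (2 * B * t)" for n
    proof -
      have [measurable]: "P n \<in> borel_measurable borel"
        using borel_measurable_integrable[OF P_int] by simp
      show ?thesis
        unfolding V_diff[OF y_int P_int, symmetric]
        using tail \<open>M \<ge> 0\<close> by (intro V_contraction) (auto simp: P_def)
    qed
    moreover have "(\<lambda>n. (2 * M / 2 ^ n) / 2 * exp (2 * B * t)) \<longlonglongrightarrow> 0"
      by (intro tendsto_mult_left_zero tendsto_divide_zero LIMSEQ_divide_realpow_zero) auto
    ultimately have "(\<lambda>n. V y t - V (P n) t) \<longlonglongrightarrow> 0"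
      by (auto intro: Lim_null_comparison[rotated])
    moreover have "(\<lambda>n. V y t - V (P n) t) \<longlonglongrightarrow> V y t - (y t - w 0 t)"
    proof -
      have "(\<lambda>n. P n t) \<longlonglongrightarrow> y t"
        unfolding P_def y_def by (rule summable_LIMSEQ[OF w_summable])
      then have "(\<lambda>n. P (Suc n) t) \<longlonglongrightarrow> y t"
        by (rule LIMSEQ_Suc)
      then show ?thesis
        unfolding VP by (intro tendsto_diff tendsto_const)
    qed
    ultimately show ?thesis
      using LIMSEQ_unique by fastforce
  qed
  then have fixpoint: "u t + y t = u t + V (\<lambda>t. u t + y t) t" for t
    using V_add[OF u y_int] by (simp add: w0)
  show ?thesis
    by (rule that[OF _ fixpoint]) (use u y_int in simp)
qed

section \<open>Reduction of the given equation to the Borel kernel\<close>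

text \<open>For almost every \<open>t\<close> the two integrands agree for almost every
  \<open>\<theta>\<close>, because the null set where \<open>Y\<close> and \<open>x\<close> differ
  stays null under translation. The integrability demanded by \<open>satisfies_eq_at\<close> is
  inherited from the integrand with \<open>K\<close> and \<open>Y\<close>.\<close>

lemma satisfies_eq_at_iff:
  assumes K_eq: "AE t in lborel. AE \<theta> in lborel.
      (t, \<theta>) \<in> {s<..s + \<tau>} \<times> {-\<tau>..0} \<longrightarrow> K (t, \<theta>) = C (t, \<theta>)"
    and Y: "integrable lborel Y"
    and Y_eq: "AE \<sigma> in lborel. \<sigma> \<in> {s - \<tau>..s + \<tau>} \<longrightarrow> Y \<sigma> = x \<sigma>"
  shows "AE t in lborel. t \<in> {s<..s + \<tau>} \<longrightarrow> (satisfies_eq_at \<tau> C x t \<longleftrightarrow> x t = V Y t)"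
  using K_eq
proof eventually_elim
  case (elim t)
  show ?case
  proof
    assume t: "t \<in> {s<..s + \<tau>}"
    have "AE \<theta> in lborel. K (t, \<theta>) *v Y (t + \<theta>) =
        indicator {-\<tau>..0} \<theta> *\<^sub>R (C (t, \<theta>) *v history x t \<theta>)"
      using elim AE_lborel_shift[OF Y_eq, of t]
    proof eventually_elim
      case (elim \<theta>)
      then show ?case
        using t by (cases "\<theta> \<in> {-\<tau>..0}") (auto simp: history_def K_support)
    qed
    from lebesgue_on_integral_eq_lborel[OF _ V_integrand_integrable[OF Y] this]
    show "satisfies_eq_at \<tau> C x t \<longleftrightarrow> x t = V Y t"
      by (simp add: satisfies_eq_at_def V_def)
  qed
qed

end

lemma Linf_on_ex_delay_kernel:
  fixes C :: "real \<times> real \<Rightarrow> real ^ 'd ^ 'd"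
  assumes "\<tau> > 0" "C \<in> Linf_on ({s..s + \<tau>} \<times> {-\<tau>..0})"
  obtains K B where "delay_kernel K s \<tau> B"
    "AE t in lborel. AE \<theta> in lborel. (t, \<theta>) \<in> {s<..s + \<tau>} \<times> {-\<tau>..0} \<longrightarrow> K (t, \<theta>) = C (t, \<theta>)"
proof -
  let ?R = "{s..s + \<tau>} \<times> {-\<tau>..0}" and ?R' = "{s<..s + \<tau>} \<times> {-\<tau>..0}"
  have R: "?R \<in> sets lebesgue"
    by (simp add: borel_closed closed_Times)
  obtain b where C: "C \<in> borel_measurable (lebesgue_on ?R)"
    and b: "AE p in lebesgue_on ?R. norm (C p) \<le> b"
    using assms(2) by (auto simp: Linf_on_def)
  obtain G where [measurable]: "G \<in> borel_measurable borel"
    and G: "AE p in lborel. p \<in> ?R \<longrightarrow> C p = G p"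
    using lebesgue_measurable_ex_borel[OF C R] by blast
  obtain c where c: "c > 0" "\<And>(A :: real ^ 'd ^ 'd) v. norm (A *v v) \<le> norm A * norm v * c"
    using bounded_bilinear.pos_bounded[OF bounded_bilinear_matrix_vector_mult] by blast
  \<comment> \<open>Cutting off where \<open>norm (G p) > b\<close> makes the bound hold everywhere
    and changes \<open>G\<close> only on a null subset of the rectangle. In \<open>B\<close>, the
    maximum with 1 keeps the constant positive.\<close>
  define K where "K p = (if p \<in> ?R' \<and> norm (G p) \<le> b then G p else 0)" for p
  define B where "B = max 1 b * c"
  have "delay_kernel K s \<tau> B"
  proof
    have [measurable]: "?R' \<in> sets borel"
      unfolding borel_prod[symmetric] by (intro pair_measureI) auto
    show "K \<in> borel_measurable borel"
      unfolding K_def[abs_def] by measurable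
    fix p and v :: "real ^ 'd"
    have "norm (K p) \<le> max 1 b"
      by (auto simp: K_def)
    then have "norm (K p) * norm v * c \<le> max 1 b * norm v * c"
      using c(1) by (intro mult_right_mono) auto
    then show "norm (K p *v v) \<le> B * norm v"
      using c(2)[of "K p" v] by (simp add: B_def mult_ac)
  qed (use assms(1) c(1) in \<open>auto simp: K_def B_def\<close>)
  moreover have "AE p in lborel. p \<in> ?R' \<longrightarrow> K p = C p"
    using G b[unfolded AE_lebesgue_on_iff[OF R]]
    by eventually_elim (auto simp: K_def)
  \<comment> \<open>Fubini for null sets: almost every section of a planar null set is null.\<close>
  then have "AE t in lborel. AE \<theta> in lborel. (t, \<theta>) \<in> ?R' \<longrightarrow> K (t, \<theta>) = C (t, \<theta>)"
    unfolding lborel_prod[symmetric] by (rule lborel_pair.AE_pair)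
  ultimately show ?thesis
    using that by blast
qed

section \<open>Existence and uniqueness for the delay equation\<close>

theorem corollary2p2:
  fixes s \<tau> :: real
    and C :: "real \<times> real \<Rightarrow> real ^ 'd ^ 'd"
    and \<phi> :: "real \<Rightarrow> real ^ 'd"
  assumes "\<tau> > 0"
    and "C \<in> Linf_on ({s..s + \<tau>} \<times> {-\<tau>..0})"
    and "\<phi> \<in> L2_on {-\<tau>..0}"
  shows "\<exists>x. x \<in> L2_on {s..s + \<tau>} \<and> is_solution s \<tau> C \<phi> x \<and>
           (\<forall>y. y \<in> L2_on {s..s + \<tau>} \<and> is_solution s \<tau> C \<phi> y \<longrightarrow>
              (AE t in lebesgue_on {s..s + \<tau>}. y t = x t))"
proof -
  obtain K B where "delay_kernel K s \<tau> B"
    and K_eq: "AE t in lborel. AE \<theta> in lborel.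
      (t, \<theta>) \<in> {s<..s + \<tau>} \<times> {-\<tau>..0} \<longrightarrow> K (t, \<theta>) = C (t, \<theta>)"
    using Linf_on_ex_delay_kernel[OF assms(1,2)] by blast
  interpret delay_kernel K s \<tau> B by fact
  obtain \<psi> where \<psi>: "integrable lborel \<psi>" "\<And>\<theta>. \<theta> \<notin> {-\<tau>..0} \<Longrightarrow> \<psi> \<theta> = 0"
      "AE \<theta> in lborel. \<theta> \<in> {-\<tau>..0} \<longrightarrow> \<psi> \<theta> = \<phi> \<theta>"
    using L2_on_ex_borel[OF assms(3)] by blast
  \<comment> \<open>The initial datum moved to \<open>[s - \<tau>, s]\<close>, in an integrable
    Borel version that is zero elsewhere.\<close>
  define u where "u t = \<psi> (- s + t)" for t
  have u_int: "integrable lborel u"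
    unfolding u_def[abs_def] by (rule lborel_integrable_shift) fact
  have u_after: "u t = 0" if "t > s" for t
    using that by (simp add: u_def \<psi>(2))
  have u_eq: "AE t in lborel. t \<in> {s - \<tau>..s} \<longrightarrow> u t = \<phi> (t - s)"
    using AE_lborel_shift[OF \<psi>(3), of "- s"]
    by eventually_elim (auto simp: u_def)
  \<comment> \<open>Dictionary between solutions and fixed points: \<open>Y\<close> is an integrable
    representative of \<open>extend_by s \<phi> y\<close> on
    \<open>[s - \<tau>, s + \<tau>]\<close>. The single point \<open>s\<close> is discarded as a
    null set.\<close>
  have is_solution_iff: "is_solution s \<tau> C \<phi> y \<longleftrightarrow> (AE t in lborel. t \<in> {s<..s + \<tau>} \<longrightarrow> Y t = V Y t)"
    if Y: "integrable lborel Y" and Y_before: "\<And>t. t < s \<Longrightarrow> Y t = u t"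
      and Y_after: "AE t in lborel. t \<in> {s<..s + \<tau>} \<longrightarrow> Y t = y t" for y Y
  proof -
    have "AE \<sigma> in lborel. \<sigma> \<in> {s - \<tau>..s + \<tau>} \<longrightarrow> Y \<sigma> = extend_by s \<phi> y \<sigma>"
      using u_eq Y_after AE_lborel_singleton[of s]
    proof eventually_elim
      case (elim \<sigma>)
      then show ?case
        using Y_before[of \<sigma>] by (cases "\<sigma> < s") (auto simp: extend_by_def)
    qed
    from satisfies_eq_at_iff[OF K_eq Y this] Y_after
    have "AE t in lborel. (t \<in> {s..s + \<tau>} \<longrightarrow> satisfies_eq_at \<tau> C (extend_by s \<phi> y) t) \<longleftrightarrow>
        (t \<in> {s<..s + \<tau>} \<longrightarrow> Y t = V Y t)"
      using AE_lborel_singleton[of s]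
      by eventually_elim (auto simp: extend_by_def)
    then show ?thesis
      unfolding is_solution_def by (subst AE_lebesgue_on_iff) (auto intro: AE_cong_simp elim: eventually_elim2)
  qed
  obtain x where x: "integrable lborel x" "\<And>t. x t = u t + V x t"
    using V_fixpoint_exists[OF u_int] by blast
  have [measurable]: "x \<in> borel_measurable borel"
    using borel_measurable_integrable[OF x(1)] by simp
  have x_after: "x t = V x t" if "t > s" for t
    using x(2)[of t] u_after[OF that] by simp
  have "x \<in> L2_on {s..s + \<tau>}"
  proof -
    \<comment> \<open>Square integrability of \<open>x\<close> comes from \<open>x = V x\<close> on
      \<open>{s<..s + \<tau>}\<close>, where \<open>V x\<close> is bounded.\<close>
    have "integrable lborel (\<lambda>t. (norm (V x t))\<^sup>2)"
    proof (rule bounded_support_integrable)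
      show "norm ((norm (V x t))\<^sup>2) \<le> (B * (\<integral>\<sigma>. norm (x \<sigma>) \<partial>lborel))\<^sup>2" for t
        using norm_V_le[OF x(1), of t] by (simp add: power_mono)
    qed (simp_all add: V_support)
    moreover have "AE t in lborel. (norm (V x t))\<^sup>2 = indicator {s..s + \<tau>} t *\<^sub>R (norm (x t))\<^sup>2"
      using AE_lborel_singleton[of s]
    proof eventually_elim
      case (elim t)
      then show ?case
        using x_after[of t] V_support[of t x] by (cases "t \<in> {s<..s + \<tau>}") auto
    qed
    ultimately have "integrable (lebesgue_on {s..s + \<tau>}) (\<lambda>t. (norm (x t))\<^sup>2)"
      by (intro lebesgue_on_integral_eq_lborel(1)) auto
    moreover have "x \<in> borel_measurable (lebesgue_on {s..s + \<tau>})"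
      by (simp add: measurable_restrict_space1 measurable_completion)
    ultimately show ?thesis
      by (simp add: L2_on_def)
  qed
  moreover have "is_solution s \<tau> C \<phi> x"
    by (subst is_solution_iff[OF x(1)]) (use x_after x(2) V_support in auto)
  moreover have "AE t in lebesgue_on {s..s + \<tau>}. y t = x t"
    if y: "y \<in> L2_on {s..s + \<tau>}" and y_sol: "is_solution s \<tau> C \<phi> y" for y
  proof -
    obtain y' where y': "integrable lborel y'" "\<And>t. t \<notin> {s..s + \<tau>} \<Longrightarrow> y' t = 0"
        "AE t in lborel. t \<in> {s..s + \<tau>} \<longrightarrow> y' t = y t"
      using L2_on_ex_borel[OF y] by blast
    \<comment> \<open>Glues the past to a representative of \<open>y\<close>; at
      \<open>t = s\<close> both summands may be nonzero, so agreement with \<open>u\<close> is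
      claimed only for \<open>t < s\<close>.\<close>
    define Y where "Y t = u t + y' t" for t
    have Y: "integrable lborel Y"
      unfolding Y_def[abs_def] using u_int y'(1) by simp
    have Y_before: "Y t = u t" if "t < s" for t
      using y'(2)[of t] that by (simp add: Y_def)
    have Y_y: "AE t in lborel. t \<in> {s<..s + \<tau>} \<longrightarrow> Y t = y t"
      using y'(3) by eventually_elim (auto simp: Y_def u_after)
    have "AE t in lborel. t \<in> {s<..s + \<tau>} \<longrightarrow> Y t = V Y t"
      using y_sol is_solution_iff[OF Y Y_before Y_y] by simp
    \<comment> \<open>Off \<open>{s<..s + \<tau>}\<close> and away from \<open>s\<close>, both
      \<open>Y\<close> and \<open>x\<close> equal \<open>u\<close> and \<open>V\<close> vanishes, so
      the difference is a fixed point of \<open>V\<close> on the whole line.\<close>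
    then have "AE t in lborel. Y t - x t = V (\<lambda>t. Y t - x t) t"
      using AE_lborel_singleton[of s]
    proof eventually_elim
      case (elim t)
      show ?case
      proof (cases "t \<in> {s<..s + \<tau>}")
        case True
        then show ?thesis
          using elim x_after[of t] by (simp add: V_diff[OF Y x(1)])
      next
        case False
        then show ?thesis
          using elim x(2)[of t] y'(2)[of t] by (auto simp: V_support Y_def)
      qed
    qed
    then have "AE t in lborel. Y t - x t = 0"
      using Y x(1) by (intro V_fixpoint_unique) auto
    then have "AE t in lborel. t \<in> {s..s + \<tau>} \<longrightarrow> y t = x t"
      using Y_y AE_lborel_singleton[of s] by eventually_elim auto
    then show ?thesis
      by (simp add: AE_lebesgue_on_iff)
  qed
  ultimately show ?thesis
    by blast
qed

end
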